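(* Suppose that integers $x, y, z, u$ (with $x\neq 1$) and odd primes $p$ and $q$ satisfy $$p\,y^q=\frac{x^p-1}{x-1},\qquad p^2 z^q=\frac{x^{p^2}-1}{x-1},\qquad p^3 u^q=\frac{x^{p^3}-1}{x-1}.$$ Then $$|x| < 17\, p^3\left(\max\left\{1,\frac{p}{q}\right\}\right)^3 q^{\,p^2+p-2+\frac{p^3-1}{q-1}}.$$
   Context: The condition $x\neq 1$ is only to make the displayed quotients defined. *)

theory Defs
  imports Complex_Main "HOL-Computational_Algebra.Primes"
begin

end

theory Submission
  imports
    Defs
    "HOL-Analysis.FPS_Convergence"
    "HOL-Analysis.Generalised_Binomial_Theorem"
    "HOL-Number_Theory.Cong"
begin

text \<open>
  Choose \<open>0 \<le> a, b < q\<close> such that \<open>a + 2b + 3 = qk\<close> and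
  \<open>(p - 1)a + (p\<^sup>2 - 1)b + (p\<^sup>3 - 1) = qN\<close>. Then the integer \<open>W = p\<^sup>k y\<^sup>a z\<^sup>b u\<close> is the
  \<open>q\<close>-th root of a monic polynomial in \<open>x\<close> of degree \<open>qN\<close>, so that \<open>W = x\<^sup>N S(1 / x)\<close> with
  \<open>S(t) = (1 - t)\<^sup>-\<^sup>(\<^sup>a\<^sup>+\<^sup>b\<^sup>+\<^sup>1\<^sup>)\<^sup>/\<^sup>q (1 - t\<^sup>p)\<^sup>a\<^sup>/\<^sup>q \<dots>\<close> a product of binomial series. Runge's method:
  truncating \<open>S\<close> after \<open>t\<^sup>N\<close> gives a polynomial \<open>P\<close> whose value at any integer is a rational number
  with denominator exactly \<open>D = q\<^sup>d\<close>, where \<open>0 < d \<le> N + v\<^sub>q(N!)\<close>, because the last coefficient is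
  \<open>q\<close>-adically strictly larger than all the others. Hence \<open>W \<noteq> P(x)\<close> and
  \<open>1 / D \<le> \<bar>W - P(x)\<bar>\<close>, whereas the tail of the series is \<open>O(N / \<bar>x\<bar>)\<close>.
\<close>

unbundle no vec_syntax
unbundle fps_syntax

section \<open>Valuations of factorials and the denominator exponent\<close>

text \<open>Legendre's formula, one level at a time: only the multiples of \<open>q\<close> up to
  \<open>n\<close> contribute, and removing one factor \<open>q\<close> from each leaves the
  factorial of \<open>n div q\<close>.\<close>

lemma multiplicity_fact_rec:
  fixes q :: nat
  assumes "prime q"
  shows "multiplicity q (fact n) = n div q + multiplicity q (fact (n div q))"
proof -
  have mult_fact: "multiplicity q (fact m) = (\<Sum>i=1..m. multiplicity q i)" for m
    using assms by (simp add: fact_prod prime_elem_multiplicity_prod_distrib)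
  have q: "q > 0" using assms prime_gt_0_nat by blast
  have img: "(\<lambda>k. q * k) ` {1..n div q} = {i \<in> {1..n}. q dvd i}"
  proof (intro set_eqI iffI)
    fix i assume "i \<in> {i \<in> {1..n}. q dvd i}"
    then obtain k where "i = q * k" "i \<ge> 1" "i \<le> n" by auto
    moreover from this have "k \<le> n div q"
      using q by (simp add: less_eq_div_iff_mult_less_eq mult.commute)
    ultimately show "i \<in> (\<lambda>k. q * k) ` {1..n div q}" using q by force
  qed (use q in \<open>auto simp: less_eq_div_iff_mult_less_eq mult.commute\<close>)
  have "multiplicity q (fact n) = (\<Sum>i\<in>{i \<in> {1..n}. q dvd i}. multiplicity q i)"
    unfolding mult_fact by (intro sum.mono_neutral_right) (auto simp: not_dvd_imp_multiplicity_0)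
  also have "\<dots> = (\<Sum>k=1..n div q. multiplicity q (q * k))"
    unfolding img[symmetric] using q by (subst sum.reindex) (auto simp: inj_on_def)
  also have "\<dots> = (\<Sum>k=1..n div q. Suc (multiplicity q k))"
    using assms by (intro sum.cong refl multiplicity_times_same) (auto dest: prime_gt_1_nat)
  also have "\<dots> = n div q + multiplicity q (fact (n div q))"
    by (simp add: mult_fact sum_Suc)
  finally show ?thesis .
qed

text \<open>With \<open>m = n div q\<close>, the recursion and the induction hypothesis give at most
  \<open>(q - 1) * m + m = q * m\<close>, which is at most \<open>n\<close>.\<close>

lemma multiplicity_fact_le:
  fixes q :: nat
  assumes "prime q"
  shows "(q - 1) * multiplicity q (fact n) \<le> n"
proof (induction n rule: less_induct)
  case (less n)
  show ?case
  proof (cases "n = 0")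
    case False
    have q: "q > 1" using assms prime_gt_1_nat by blast
    define m where "m = n div q"
    have "m < n" using False q by (simp add: m_def)
    then have "(q - 1) * (m + multiplicity q (fact m)) \<le> (q - 1) * m + m"
      using less by (simp add: distrib_left)
    also have "\<dots> = q * m" using q by (cases q) auto
    also have "\<dots> \<le> n" by (simp add: m_def)
    finally show ?thesis by (simp only: multiplicity_fact_rec[OF assms, of n] m_def)
  qed simp
qed

text \<open>The power of \<open>q\<close> in the denominator of the binomial coefficient of
  \<open>k / q\<close> over \<open>n\<close>, for \<open>k\<close> prime to \<open>q\<close>: the
  \<open>n\<close> factors \<open>k / q - i\<close> give \<open>n\<close>, the factorial gives the
  rest.\<close>

definition den_exp :: "nat \<Rightarrow> nat \<Rightarrow> nat" where
  "den_exp q n = n + multiplicity q (fact n)"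

lemma den_exp_0 [simp]: "den_exp q 0 = 0"
  by (simp add: den_exp_def)

lemma den_exp_superadd:
  assumes "prime q"
  shows "den_exp q i + den_exp q j \<le> den_exp q (i + j)"
proof -
  have "multiplicity q (fact i * fact j) \<le> multiplicity q (fact (i + j))"
    by (intro dvd_imp_multiplicity_le fact_fact_dvd_fact) auto
  then show ?thesis
    using assms by (simp add: den_exp_def prime_elem_multiplicity_mult_distrib)
qed

text \<open>Strictness comes from the summand \<open>n\<close>. It later provides the spare factor
  \<open>q\<close> that separates the top coefficient from all others.\<close>

lemma den_exp_strict_mono:
  assumes "i < j"
  shows "den_exp q i < den_exp q j"
proof -
  have "multiplicity q (fact i) \<le> multiplicity q (fact j)"
    by (intro dvd_imp_multiplicity_le fact_dvd) (use assms in auto)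
  then show ?thesis using assms by (simp add: den_exp_def)
qed

lemma den_exp_mono: "i \<le> j \<Longrightarrow> den_exp q i \<le> den_exp q j"
  using den_exp_strict_mono[of i j q] by (cases "i = j") auto

lemma den_exp_le:
  assumes "prime q"
  shows "real (den_exp q n) \<le> real q * real n / (real q - 1)"
proof -
  have q: "q > 1" using assms prime_gt_1_nat by blast
  have "real ((q - 1) * multiplicity q (fact n)) \<le> real n"
    using multiplicity_fact_le[OF assms] by (simp only: of_nat_le_iff)
  then have "(real q - 1) * real (multiplicity q (fact n)) \<le> real n"
    using q by (simp add: of_nat_diff)
  then show ?thesis using q by (simp add: den_exp_def field_simps)
qed

section \<open>Denominators of binomial coefficients of \<open>k / q\<close>\<close>

text \<open>The quotient is an ordinary binomial coefficient of \<open>nat M\<close>.\<close>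

lemma fact_dvd_prod_diff:
  fixes M :: int
  assumes "M \<ge> 0"
  shows "fact j dvd (\<Prod>i<j. M - int i)"
proof -
  have "real_of_int (\<Prod>i<j. M - int i) = real_of_int (fact j * int (nat M choose j))"
    using assms gbinomial_mult_fact[of j "real (nat M)"]
    by (simp add: binomial_gbinomial atLeast0LessThan)
  then have "(\<Prod>i<j. M - int i) = fact j * int (nat M choose j)" by linarith
  then show ?thesis by simp
qed

text \<open>Away from \<open>q\<close>, the number \<open>k / q\<close> is congruent to an integer, so only powers of \<open>q\<close>
  survive in the denominator of a binomial coefficient of \<open>k / q\<close>.\<close>

lemma gbinomial_denominator:
  fixes k :: int
  assumes "prime q"
  shows "\<exists>r::int. real q ^ den_exp q j * (real_of_int k / real q gchoose j) = real_of_int r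
           \<and> (\<not> int q dvd k \<longrightarrow> \<not> int q dvd r)"
proof -
  have q: "q > 0" using assms prime_gt_0_nat by blast
  define v where "v = multiplicity q (fact j :: nat)"
  obtain w where w: "fact j = q ^ v * w" "\<not> q dvd w"
    using multiplicity_decompose'[of "fact j :: nat" q] assms not_prime_unit unfolding v_def
    by (metis fact_nonzero)
  define P where "P = (\<Prod>i<j. k - int i * int q)"
  have "coprime (int q) (int w)"
    using w(2) assms by (simp add: prime_imp_coprime)
  \<comment> \<open>\<open>s\<close> inverts \<open>q\<close> modulo \<open>w\<close>, the part of
    \<open>fact j\<close> prime to \<open>q\<close>.\<close>
  then obtain s where s: "[int q * s = 1] (mod int w)"
    using cong_solve_coprime_int by blast
  have w0: "int w > 0" using w(1) by (metis fact_nonzero gr0I mult_0_right of_nat_0_less_iff)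
  \<comment> \<open>\<open>M\<close> stands for \<open>k / q\<close> modulo \<open>w\<close>; the
    residue is nonnegative, as \<open>fact_dvd_prod_diff\<close> requires.\<close>
  define M where "M = (k * s) mod int w"
  have "int w dvd s ^ j * P"
  proof -
    have "[(\<Prod>i<j. s * (k - int i * int q)) = (\<Prod>i<j. M - int i)] (mod int w)"
    proof (rule cong_prod)
      fix i
      have "[s * k - int i * (int q * s) = M - int i * 1] (mod int w)"
        by (intro cong_diff cong_mult s cong_refl) (simp add: M_def cong_def mult.commute)
      then show "[s * (k - int i * int q) = M - int i] (mod int w)"
        by (simp add: algebra_simps)
    qed
    moreover have "int w dvd (\<Prod>i<j. M - int i)"
    proof -
      have "int w dvd fact j" by (metis dvd_triv_right int_dvd_int_iff of_nat_fact w(1))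
      then show ?thesis using fact_dvd_prod_diff[of M j] w0 by (auto simp: M_def intro: dvd_trans)
    qed
    ultimately show ?thesis
      by (simp add: P_def prod.distrib cong_dvd_iff)
  qed
  moreover have "coprime (int w) (s ^ j)"
    using s by (metis cong_imp_coprime cong_sym coprime_1_left coprime_commute coprime_mult_left_iff
        coprime_power_right_iff)
  ultimately obtain r where r: "P = int w * r"
    using coprime_dvd_mult_right_iff by (metis dvdE)
  have "(real_of_int k / real q gchoose j) = (\<Prod>i<j. real_of_int k / real q - real i) / fact j"
    by (simp add: gbinomial_prod_rev atLeast0LessThan)
  also have "(\<Prod>i<j. real_of_int k / real q - real i) = (\<Prod>i<j. real_of_int (k - int i * int q) / real q)"
    using q by (intro prod.cong) (auto simp: field_simps)
  also have "\<dots> = real_of_int P / real q ^ j"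
    by (simp add: prod_dividef P_def)
  also have "fact j = real q ^ v * real w"
    using arg_cong[OF w(1), of real] by simp
  finally have "real q ^ den_exp q j * (real_of_int k / real q gchoose j) = real_of_int r"
    using q w0 by (simp add: r den_exp_def v_def[symmetric] power_add field_simps)
  \<comment> \<open>Modulo \<open>q\<close> every factor of \<open>P\<close> is \<open>k\<close>, so
    \<open>q\<close> divides \<open>P\<close> only if it divides \<open>k\<close>.\<close>
  moreover have "\<not> int q dvd r" if "\<not> int q dvd k"
  proof
    assume "int q dvd r"
    then have "int q dvd P" by (simp add: r)
    moreover have "prime (int q)" using assms by simp
    ultimately obtain i where "int q dvd k - int i * int q"
      unfolding P_def by (auto simp: prime_dvd_prod_iff)
    with that show False by (metis dvd_triv_right diff_add_cancel dvd_add)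
  qed
  ultimately show ?thesis by blast
qed

section \<open>Binomial series in powers of the variable\<close>

text \<open>The expansion of \<open>(1 - t ^ e) powr \<alpha>\<close> at
  \<open>t = 0\<close>.\<close>

definition binom_fps :: "real \<Rightarrow> nat \<Rightarrow> real fps" where
  "binom_fps \<alpha> e = Abs_fps (\<lambda>n. if e dvd n then (\<alpha> gchoose (n div e)) * (-1) ^ (n div e) else 0)"

lemma binom_fps_nth:
  "binom_fps \<alpha> e $ n = (if e dvd n then (\<alpha> gchoose (n div e)) * (-1) ^ (n div e) else 0)"
  by (simp add: binom_fps_def)

lemma binom_fps_nth_0 [simp]: "binom_fps \<alpha> e $ 0 = 1"
  by (simp add: binom_fps_nth)

lemma binom_fps_sums:
  assumes "e > 0" "\<bar>t\<bar> < 1"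
  shows "(\<lambda>n. binom_fps \<alpha> e $ n * t ^ n) sums (1 - t ^ e) powr \<alpha>"
proof -
  have "\<bar>t ^ e\<bar> < 1" using assms by (simp add: power_abs power_less_one_iff)
  then have "(\<lambda>n. (\<alpha> gchoose n) * (- (t ^ e)) ^ n) sums (1 + - (t ^ e)) powr \<alpha>"
    by (intro gen_binomial_real) auto
  also have "(\<lambda>n. (\<alpha> gchoose n) * (- (t ^ e)) ^ n) = (\<lambda>n. binom_fps \<alpha> e $ (e * n) * t ^ (e * n))"
    using assms(1) by (auto simp: binom_fps_nth power_mult power_minus[of "t ^ e"])
  \<comment> \<open>Coefficients at indices outside the multiples of \<open>e\<close> vanish, so the
    sum may be reindexed along \<open>e * n\<close>.\<close>
  finally show ?thesis
    using assms(1)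
    by (subst (asm) sums_mono_reindex[of "\<lambda>n. e * n" "\<lambda>n. binom_fps \<alpha> e $ n * t ^ n"])
       (auto simp: strict_mono_def binom_fps_nth)
qed

lemma fps_conv_radius_binom_fps:
  assumes "e > 0"
  shows "fps_conv_radius (binom_fps \<alpha> e) \<ge> 1"
  unfolding fps_conv_radius_def
proof (rule conv_radius_geI_ex')
  fix r :: real assume "0 < r" "ereal r < 1"
  then show "summable (\<lambda>n. binom_fps \<alpha> e $ n * of_real r ^ n)"
    using binom_fps_sums[OF assms, of r \<alpha>] by (auto simp: sums_iff)
qed

lemma eval_binom_fps:
  assumes "e > 0" "\<bar>t\<bar> < 1"
  shows "eval_fps (binom_fps \<alpha> e) t = (1 - t ^ e) powr \<alpha>"
  using binom_fps_sums[OF assms] by (simp add: eval_fps_def sums_iff)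

lemma fps_conv_radius_mult_ge:
  assumes "fps_conv_radius F \<ge> c" "fps_conv_radius G \<ge> c"
  shows "fps_conv_radius (F * G) \<ge> c"
  by (rule order_trans[OF _ fps_conv_radius_mult]) (use assms in simp)

section \<open>Power series with powers of \<open>q\<close> as denominators\<close>

definition den_le :: "nat \<Rightarrow> (nat \<Rightarrow> nat) \<Rightarrow> real fps \<Rightarrow> bool" where
  "den_le q g F \<longleftrightarrow> (\<forall>n. real q ^ g n * F $ n \<in> \<int>)"

text \<open>In each term of the Cauchy product the two exponents add up to at most
  \<open>g n\<close>, so a nonnegative power of \<open>q\<close> is left over.\<close>

lemma den_le_mult:
  assumes F: "den_le q g F" and G: "den_le q g G"
    and g: "\<And>i j. g i + g j \<le> g (i + j)"
  shows "den_le q g (F * G)"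
  unfolding den_le_def
proof
  fix n
  have "real q ^ g n * (F $ i * G $ (n - i)) \<in> \<int>" if "i \<le> n" for i
  proof -
    have "g n = (g n - g i - g (n - i)) + g i + g (n - i)"
      using g[of i "n - i"] that by simp
    then have "real q ^ g n = real q ^ (g n - g i - g (n - i)) * real q ^ g i * real q ^ g (n - i)"
      by (metis power_add)
    then have "real q ^ g n * (F $ i * G $ (n - i))
      = real q ^ (g n - g i - g (n - i)) * ((real q ^ g i * F $ i) * (real q ^ g (n - i) * G $ (n - i)))"
      by simp
    also have "\<dots> \<in> \<int>"
      by (rule Ints_mult[OF Ints_power Ints_mult]) (use F G in \<open>auto simp: den_le_def\<close>)
    finally show ?thesis .
  qed
  then show "real q ^ g n * (F * G) $ n \<in> \<int>"
    by (auto simp: fps_mult_nth sum_distrib_left intro: Ints_sum)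
qed

lemma den_le_mono:
  assumes "den_le q g F" "\<And>n. g n \<le> h n"
  shows "den_le q h F"
  unfolding den_le_def
proof
  fix n
  have "real q ^ h n * F $ n = real q ^ (h n - g n) * (real q ^ g n * F $ n)"
    using assms(2)[of n] by (simp flip: power_add mult.assoc)
  also have "\<dots> \<in> \<int>"
    by (rule Ints_mult[OF Ints_power]) (use assms(1) in \<open>auto simp: den_le_def\<close>)
  finally show "real q ^ h n * F $ n \<in> \<int>" .
qed

lemma den_le_binom_fps:
  assumes "prime q"
  shows "den_le q (\<lambda>n. den_exp q (n div e)) (binom_fps (real_of_int k / real q) e)"
  unfolding den_le_def
proof
  fix n
  obtain r :: int where
    "real q ^ den_exp q (n div e) * (real_of_int k / real q gchoose (n div e)) = real_of_int r"
    using gbinomial_denominator[OF assms] by blast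
  then show "real q ^ den_exp q (n div e) * binom_fps (real_of_int k / real q) e $ n \<in> \<int>"
    by (auto simp: binom_fps_nth simp flip: mult.assoc intro!: Ints_mult Ints_power)
qed

text \<open>Supplies the one coefficient with a maximal denominator on which
  \<open>truncation_denominator\<close> rests; the sign does not affect divisibility by
  \<open>q\<close>.\<close>

lemma binom_fps_exact_denominator:
  assumes "prime q" "\<not> int q dvd k" "e dvd n"
  shows "\<exists>r::int. real q ^ den_exp q (n div e) * binom_fps (real_of_int k / real q) e $ n = real_of_int r
           \<and> \<not> int q dvd r"
proof -
  obtain r :: int where r:
    "real q ^ den_exp q (n div e) * (real_of_int k / real q gchoose (n div e)) = real_of_int r"
    "\<not> int q dvd r"
    using gbinomial_denominator[OF assms(1)] assms(2) by blast
  have "\<not> int q dvd r * (-1) ^ (n div e)"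
    using r(2) by (cases "even (n div e)") auto
  then show ?thesis
    using r(1) assms(3)
    by (intro exI[of _ "r * (-1) ^ (n div e)"]) (auto simp: binom_fps_nth simp flip: mult.assoc)
qed

lemma den_exp_div_superadd:
  assumes "prime q"
  shows "den_exp q (i div e) + den_exp q (j div e) \<le> den_exp q ((i + j) div e)"
  by (rule order_trans[OF den_exp_superadd[OF assms] den_exp_mono]) (simp only: div_add1_eq[of i j e] le_add1)

section \<open>Runge's method: denominator and error of the truncation\<close>

text \<open>The constant term of \<open>H\<close> being \<open>1\<close>, the single product \<open>F\<^sub>N\<close> has a larger denominator
  than everything else contributing to the sum, whatever the integer \<open>x\<close>.\<close>

lemma truncation_denominator:
  fixes x :: int and F H :: "real fps"
  assumes q: "prime q" and p: "p \<ge> 2" and e: "e > 0" "e dvd N"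
    and F: "den_le q (\<lambda>n. den_exp q (n div e)) F"
    and H: "den_le q (\<lambda>n. den_exp q (n div (e * p))) H" "H $ 0 = 1"
    and r: "real q ^ den_exp q (N div e) * F $ N = real_of_int r" "\<not> int q dvd r"
  shows "\<exists>k::int. real q ^ den_exp q (N div e) * (\<Sum>n\<le>N. (F * H) $ n * real_of_int x ^ (N - n)) = real_of_int k
           \<and> \<not> int q dvd k"
proof -
  define d where "d = den_exp q (N div e)"
  have q0: "q > 0" using q prime_gt_0_nat by blast
  \<comment> \<open>Every product except \<open>H $ 0 * F $ N\<close> stays integral even after
    giving up one factor \<open>q\<close>.\<close>
  have small: "real q ^ d * (H $ i * F $ (n - i)) / real q \<in> \<int>"
    if "i \<le> n" "n \<le> N" "i > 0 \<or> n < N" for i n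
  proof -
    have "e * (i div (e * p) + (n - i) div e) < N"
    proof -
      \<comment> \<open>For \<open>i > 0\<close> the loss is strict because
        \<open>i div p < i\<close>; for \<open>i = 0\<close> it comes from
        \<open>n < N\<close>.\<close>
      have "e * (i div (e * p)) = e * ((i div p) div e)"
        by (metis div_mult2_eq mult.commute)
      also have "\<dots> \<le> i div p" by simp
      finally have "e * (i div (e * p) + (n - i) div e) \<le> i div p + (n - i)"
        unfolding distrib_left by (intro add_mono) auto
      also have "\<dots> < N"
      proof (cases "i = 0")
        case False
        then have "i div p < i" using p by (simp add: div_less_dividend)
        then show ?thesis using that by linarith
      qed (use that in auto)
      finally show ?thesis .
    qed
    also have "N = e * (N div e)" using e by simp
    finally have "i div (e * p) + (n - i) div e < N div e" by (simp only: mult_less_cancel1)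
    then have lt: "den_exp q (i div (e * p)) + den_exp q ((n - i) div e) < d"
      unfolding d_def using den_exp_superadd[OF q] den_exp_strict_mono le_less_trans by blast
    \<comment> \<open>The power of \<open>q\<close> remaining after both denominators are cleared
      and one factor \<open>q\<close> is set aside.\<close>
    define c where "c = d - 1 - den_exp q (i div (e * p)) - den_exp q ((n - i) div e)"
    have "d = Suc (c + den_exp q (i div (e * p)) + den_exp q ((n - i) div e))"
      using lt by (simp add: c_def)
    then have "real q ^ d * (H $ i * F $ (n - i)) / real q = real q ^ c *
       ((real q ^ den_exp q (i div (e * p)) * H $ i) * (real q ^ den_exp q ((n - i) div e) * F $ (n - i)))"
      using q0 by (simp add: power_add)
    also have "\<dots> \<in> \<int>"
      by (rule Ints_mult[OF Ints_power Ints_mult]) (use F H in \<open>auto simp: den_le_def\<close>)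
    finally show ?thesis .
  qed
  have FH: "(F * H) $ n = (\<Sum>i=0..n. H $ i * F $ (n - i))" for n
    by (simp add: mult.commute[of F] fps_mult_nth)
  have low: "real q ^ d * (F * H) $ n / real q \<in> \<int>" if "n < N" for n
    unfolding FH sum_distrib_left sum_divide_distrib
    using that by (intro Ints_sum small) auto
  \<comment> \<open>The index \<open>i = 0\<close> is split off: it contributes
    \<open>F $ N\<close>, the only term that may fail to be integral after division by
    \<open>q\<close>.\<close>
  have "(F * H) $ N = F $ N + (\<Sum>i\<in>{0<..N}. H $ i * F $ (N - i))"
    unfolding FH by (subst sum.head) (auto simp: H)
  then have "real q ^ d * (F * H) $ N / real q
     = real_of_int r / real q + (\<Sum>i\<in>{0<..N}. real q ^ d * (H $ i * F $ (N - i)) / real q)"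
    using r(1) by (simp add: d_def sum_distrib_left sum_divide_distrib distrib_left add_divide_distrib)
  moreover have "(\<Sum>i\<in>{0<..N}. real q ^ d * (H $ i * F $ (N - i)) / real q) \<in> \<int>"
    by (intro Ints_sum small) auto
  then obtain s :: int where
    "(\<Sum>i\<in>{0<..N}. real q ^ d * (H $ i * F $ (N - i)) / real q) = real_of_int s"
    by (rule Ints_cases)
  ultimately have s: "real q ^ d * (F * H) $ N / real q = real_of_int r / real q + real_of_int s"
    by simp
  have "(\<Sum>n<N. (real q ^ d * (F * H) $ n / real q) * real_of_int x ^ (N - n)) \<in> \<int>"
    by (intro Ints_sum Ints_mult low Ints_power) auto
  then obtain t :: int where t:
    "(\<Sum>n<N. (real q ^ d * (F * H) $ n / real q) * real_of_int x ^ (N - n)) = real_of_int t"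
    by (rule Ints_cases)
  have "real q ^ d * (\<Sum>n\<le>N. (F * H) $ n * real_of_int x ^ (N - n)) / real q
     = (\<Sum>n<N. (real q ^ d * (F * H) $ n / real q) * real_of_int x ^ (N - n)) + real q ^ d * (F * H) $ N / real q"
    by (simp add: lessThan_Suc_atMost[symmetric] sum_distrib_left sum_divide_distrib distrib_left
        add_divide_distrib mult.assoc)
  also have "\<dots> = real_of_int (r + int q * (s + t)) / real q"
    unfolding s t using q0 by (simp add: field_simps)
  finally have "real q ^ d * (\<Sum>n\<le>N. (F * H) $ n * real_of_int x ^ (N - n)) = real_of_int (r + int q * (s + t))"
    using q0 by simp
  moreover have "\<not> int q dvd r + int q * (s + t)"
    using r(2) by (simp add: dvd_add_left_iff)
  ultimately show ?thesis unfolding d_def by blast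
qed

text \<open>The coefficients grow linearly, and \<open>i + 1 \<le> 2 ^ i\<close> dominates the tail
  by a geometric series of ratio \<open>2 / \<bar>X\<bar>\<close>. This is the source of the
  condition \<open>\<bar>X\<bar> > 2\<close> and of the denominator
  \<open>\<bar>X\<bar> - 2\<close>.\<close>

lemma truncation_error:
  fixes X :: real and F :: "real fps"
  assumes F: "\<And>n. \<bar>F $ n\<bar> \<le> C * (real n + 1)" and X: "\<bar>X\<bar> > 2"
    and radius: "fps_conv_radius F \<ge> 1"
  shows "\<bar>X ^ N * eval_fps F (1 / X) - (\<Sum>n\<le>N. F $ n * X ^ (N - n))\<bar> \<le> C * (real N + 2) / (\<bar>X\<bar> - 2)"
proof -
  define r where "r = 1 / \<bar>X\<bar>"
  have r: "0 < r" "2 * r < 1" using X by (auto simp: r_def field_simps)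
  have C: "C \<ge> 0" using F[of 0] by simp
  have "ereal (norm (1 / X)) < fps_conv_radius F"
    using radius r by (intro less_le_trans[OF _ radius]) (simp add: r_def one_ereal_def)
  then have sm: "summable (\<lambda>n. F $ n * (1 / X) ^ n)" by (rule summable_fps)
  have "eval_fps F (1 / X) = (\<Sum>i. F $ (i + Suc N) * (1 / X) ^ (i + Suc N)) + (\<Sum>n<Suc N. F $ n * (1 / X) ^ n)"
    unfolding eval_fps_def by (rule suminf_split_initial_segment[OF sm])
  then have "X ^ N * eval_fps F (1 / X) = X ^ N * (\<Sum>i. F $ (i + Suc N) * (1 / X) ^ (i + Suc N))
      + (\<Sum>n<Suc N. X ^ N * (F $ n * (1 / X) ^ n))"
    by (simp only: distrib_left sum_distrib_left)
  also have "(\<Sum>n<Suc N. X ^ N * (F $ n * (1 / X) ^ n)) = (\<Sum>n\<le>N. F $ n * X ^ (N - n))"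
    unfolding lessThan_Suc_atMost using X
    by (intro sum.cong refl) (auto simp: power_diff power_one_over divide_simps)
  also have "X ^ N * (\<Sum>i. F $ (i + Suc N) * (1 / X) ^ (i + Suc N))
      = (\<Sum>i. X ^ N * (F $ (i + Suc N) * (1 / X) ^ (i + Suc N)))"
    by (rule suminf_mult[symmetric, OF summable_ignore_initial_segment[OF sm]])
  also have "(\<lambda>i. X ^ N * (F $ (i + Suc N) * (1 / X) ^ (i + Suc N))) = (\<lambda>i. F $ (i + Suc N) * (1 / X) ^ Suc i)"
    using X by (intro ext) (auto simp: power_add power_one_over divide_simps)
  finally have eq: "X ^ N * eval_fps F (1 / X) - (\<Sum>n\<le>N. F $ n * X ^ (N - n))
      = (\<Sum>i. F $ (i + Suc N) * (1 / X) ^ Suc i)" by simp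
  have geo: "(\<lambda>i. C * (real N + 2) * r * (2 * r) ^ i) sums (C * (real N + 2) * r * (1 / (1 - 2 * r)))"
    using r by (intro sums_mult geometric_sums) auto
  have "norm (\<Sum>i. F $ (i + Suc N) * (1 / X) ^ Suc i) \<le> (\<Sum>i. C * (real N + 2) * r * (2 * r) ^ i)"
  proof (rule norm_suminf_le)
    fix i
    have "real i + 1 \<le> 2 ^ i" by (induction i) auto
    then have "(real N + 2) * (real i + 1) \<le> (real N + 2) * 2 ^ i" by (intro mult_left_mono) auto
    moreover have "real (i + Suc N) + 1 \<le> (real N + 2) * (real i + 1)" by (simp add: algebra_simps)
    ultimately have "real (i + Suc N) + 1 \<le> (real N + 2) * 2 ^ i" by (rule order_trans[rotated])
    then have "C * (real (i + Suc N) + 1) \<le> C * ((real N + 2) * 2 ^ i)"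
      using C by (rule mult_left_mono)
    then have "\<bar>F $ (i + Suc N)\<bar> \<le> C * ((real N + 2) * 2 ^ i)"
      using F[of "i + Suc N"] by linarith
    then have "\<bar>F $ (i + Suc N)\<bar> * r ^ Suc i \<le> C * ((real N + 2) * 2 ^ i) * r ^ Suc i"
      using r by (intro mult_right_mono) auto
    moreover have "norm (F $ (i + Suc N) * (1 / X) ^ Suc i) = \<bar>F $ (i + Suc N)\<bar> * r ^ Suc i"
      by (simp only: real_norm_def abs_mult power_abs abs_divide r_def abs_one)
    ultimately show "norm (F $ (i + Suc N) * (1 / X) ^ Suc i) \<le> C * (real N + 2) * r * (2 * r) ^ i"
      by (simp add: power_mult_distrib[of 2 r] mult_ac)
  qed (use geo in \<open>simp add: sums_iff\<close>)
  also have "\<dots> = C * (real N + 2) * r * (1 / (1 - 2 * r))" using geo by (simp add: sums_iff)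
  finally have "norm (\<Sum>i. F $ (i + Suc N) * (1 / X) ^ Suc i) \<le> C * (real N + 2) * (r * (1 / (1 - 2 * r)))"
    by (simp only: mult.assoc)
  moreover have "r * (1 / (1 - 2 * r)) = 1 / (\<bar>X\<bar> - 2)"
  proof -
    have "1 - 2 * r = (\<bar>X\<bar> - 2) * r" using X by (simp add: r_def algebra_simps)
    then show ?thesis using r by simp
  qed
  ultimately have "norm (\<Sum>i. F $ (i + Suc N) * (1 / X) ^ Suc i) \<le> C * (real N + 2) * (1 / (\<bar>X\<bar> - 2))"
    by (simp only:)
  then show ?thesis by (simp only: eq real_norm_def times_divide_eq_right mult_1_right)
qed

text \<open>The integer \<open>D * W - k\<close> is nonzero since \<open>q\<close> divides
  \<open>D * W\<close> but not \<open>k\<close>. Its absolute value is therefore at least 1, while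
  it equals \<open>D\<close> times the truncation error.\<close>

lemma runge_bound:
  fixes x W :: int and F H :: "real fps"
  assumes q: "prime q" and p: "p \<ge> 2" and e: "e > 0" "e dvd N" and N: "N > 0"
    and F: "den_le q (\<lambda>n. den_exp q (n div e)) F"
    and H: "den_le q (\<lambda>n. den_exp q (n div (e * p))) H" "H $ 0 = 1"
    and r: "real q ^ den_exp q (N div e) * F $ N = real_of_int r" "\<not> int q dvd r"
    and bound: "\<And>n. \<bar>(F * H) $ n\<bar> \<le> C * (real n + 1)" and x: "\<bar>x\<bar> > 2"
    and radius: "fps_conv_radius (F * H) \<ge> 1"
    and W: "real_of_int W = real_of_int x ^ N * eval_fps (F * H) (1 / real_of_int x)"
  shows "real_of_int \<bar>x\<bar> - 2 \<le> C * (real N + 2) * real q ^ den_exp q (N div e)"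
proof -
  define D where "D = real q ^ den_exp q (N div e)"
  define P where "P = (\<Sum>n\<le>N. (F * H) $ n * real_of_int x ^ (N - n))"
  obtain k :: int where k: "D * P = real_of_int k" "\<not> int q dvd k"
    unfolding D_def P_def using truncation_denominator[OF q p e F H r] by blast
  \<comment> \<open>A positive exponent is what makes \<open>D\<close> divisible by
    \<open>q\<close>.\<close>
  have "N div e > 0" using N e by (auto elim!: dvdE)
  then have "den_exp q (N div e) > 0" by (simp add: den_exp_def)
  then have "int q dvd int q ^ den_exp q (N div e) * W"
    by (simp add: dvd_mult2)
  then have "int q ^ den_exp q (N div e) * W - k \<noteq> 0" using k(2) by auto
  then have "1 \<le> \<bar>int q ^ den_exp q (N div e) * W - k\<bar>" by linarith
  then have "1 \<le> real_of_int \<bar>int q ^ den_exp q (N div e) * W - k\<bar>" by linarith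
  also have "\<dots> = \<bar>D * (real_of_int W - P)\<bar>"
    using k(1) by (simp add: D_def right_diff_distrib)
  also have "\<dots> = D * \<bar>real_of_int W - P\<bar>" by (simp add: D_def abs_mult)
  also have "\<dots> \<le> D * (C * (real N + 2) / (\<bar>real_of_int x\<bar> - 2))"
    unfolding W P_def using x by (intro mult_left_mono truncation_error bound radius) (auto simp: D_def)
  finally show ?thesis
    using x by (simp add: D_def field_simps)
qed

section \<open>Growth of the coefficients\<close>

text \<open>Rising factorials absorb the alternating sign, so the sign of a coefficient can be read
  off its factors.\<close>

lemma gbinomial_alternating: "(\<alpha> gchoose j) * (-1) ^ j = pochhammer (- \<alpha>) j / fact j"
  for \<alpha> :: real
proof -
  have "(\<alpha> gchoose j) * (-1) ^ j = ((-1) ^ j * (-1) ^ j) * (pochhammer (- \<alpha>) j / fact j)"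
    by (simp add: gbinomial_pochhammer mult_ac)
  also have "(-1 :: real) ^ j * (-1) ^ j = 1"
    by (subst power_add[symmetric]) simp
  finally show ?thesis by simp
qed

text \<open>All nonzero coefficients after the constant term 1 are negative, and the partial sums,
  being signed binomial coefficients of \<open>\<alpha> - 1\<close>, are nonnegative. Hence the
  negative part has total size at most 1.\<close>

lemma binom_fps_abs_sum_le:
  assumes "0 \<le> \<alpha>" "\<alpha> \<le> 1" "e > 0"
  shows "(\<Sum>i\<le>n. \<bar>binom_fps \<alpha> e $ i\<bar>) \<le> 2"
proof -
  have sgn: "(\<alpha> gchoose Suc j) * (-1) ^ Suc j \<le> 0" "(\<alpha> - 1 gchoose j) * (-1) ^ j \<ge> 0" for j
  proof -
    have nonneg: "pochhammer (1 - \<alpha>) j \<ge> 0"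
      using assms by (auto simp: pochhammer_prod intro!: prod_nonneg)
    then show "(\<alpha> - 1 gchoose j) * (-1) ^ j \<ge> 0"
      unfolding gbinomial_alternating by simp
    have "pochhammer (- \<alpha>) (Suc j) = - (\<alpha> * pochhammer (1 - \<alpha>) j)"
      by (simp add: pochhammer_rec)
    moreover have "\<alpha> * pochhammer (1 - \<alpha>) j \<ge> 0" using nonneg assms by simp
    ultimately show "(\<alpha> gchoose Suc j) * (-1) ^ Suc j \<le> 0"
      unfolding gbinomial_alternating by (simp add: divide_nonpos_pos)
  qed
  define b where "b j = (\<alpha> gchoose j) * (-1) ^ j" for j
  have "(\<Sum>i\<le>n. \<bar>binom_fps \<alpha> e $ i\<bar>) = (\<Sum>i\<in>{i \<in> {..n}. e dvd i}. \<bar>b (i div e)\<bar>)"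
    by (intro sum.mono_neutral_cong_right) (auto simp: binom_fps_nth b_def)
  also have "\<dots> = (\<Sum>j\<in>{..n div e}. \<bar>b j\<bar>)"
    using assms(3) by (intro sum.reindex_bij_witness[of _ "\<lambda>j. e * j" "\<lambda>i. i div e"])
      (auto simp: div_le_mono less_eq_div_iff_mult_less_eq mult.commute)
  also have "\<dots> = \<bar>b 0\<bar> + (\<Sum>j\<in>{0<..n div e}. \<bar>b j\<bar>)"
    by (simp only: atMost_atLeast0) (subst sum.head, auto)
  also have "(\<Sum>j\<in>{0<..n div e}. \<bar>b j\<bar>) = (\<Sum>j\<in>{0<..n div e}. - b j)"
  proof (intro sum.cong refl)
    fix j assume "j \<in> {0<..n div e}"
    then obtain i where "j = Suc i" by (cases j) auto
    then show "\<bar>b j\<bar> = - b j" using sgn(1)[of i] by (simp add: b_def)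
  qed
  also have "\<dots> = b 0 - (\<Sum>j\<in>{..n div e}. b j)"
    by (simp only: atMost_atLeast0) (subst sum.head, auto simp: sum_negf)
  finally have "(\<Sum>i\<le>n. \<bar>binom_fps \<alpha> e $ i\<bar>) = \<bar>b 0\<bar> + (b 0 - (\<Sum>j\<in>{..n div e}. b j))" .
  moreover have "(\<Sum>j\<in>{..n div e}. b j) \<ge> 0"
    unfolding b_def gbinomial_sum_lower_neg using sgn(2) by (simp add: mult.commute)
  ultimately have "(\<Sum>i\<le>n. \<bar>binom_fps \<alpha> e $ i\<bar>) \<le> \<bar>b 0\<bar> + b 0" by linarith
  then show ?thesis by (simp add: b_def)
qed

text \<open>Linear growth survives multiplication by a series with bounded absolute coefficient
  sums; only the constant is multiplied by \<open>B\<close>.\<close>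

lemma fps_mult_nth_bound:
  fixes F H :: "real fps"
  assumes F: "\<And>n. \<bar>F $ n\<bar> \<le> C * (real n + 1)" and H: "\<And>n. (\<Sum>i\<le>n. \<bar>H $ i\<bar>) \<le> B"
  shows "\<bar>(F * H) $ n\<bar> \<le> (C * B) * (real n + 1)"
proof -
  have C: "C \<ge> 0" using F[of 0] by simp
  have "\<bar>(F * H) $ n\<bar> = \<bar>\<Sum>i\<le>n. H $ i * F $ (n - i)\<bar>"
    by (simp add: mult.commute[of F] fps_mult_nth atMost_atLeast0)
  also have "\<dots> \<le> (\<Sum>i\<le>n. \<bar>H $ i\<bar> * \<bar>F $ (n - i)\<bar>)"
    using sum_abs by (rule order_trans) (simp add: abs_mult)
  also have "\<dots> \<le> (\<Sum>i\<le>n. \<bar>H $ i\<bar> * (C * (real n + 1)))"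
  proof (intro sum_mono mult_left_mono)
    fix i
    have "C * (real (n - i) + 1) \<le> C * (real n + 1)" using C by (intro mult_left_mono) auto
    with F[of "n - i"] show "\<bar>F $ (n - i)\<bar> \<le> C * (real n + 1)" by linarith
  qed auto
  also have "\<dots> = (\<Sum>i\<le>n. \<bar>H $ i\<bar>) * (C * (real n + 1))" by (simp add: sum_distrib_right)
  also have "\<dots> \<le> B * (C * (real n + 1))" using C H by (intro mult_right_mono) auto
  finally show ?thesis by (simp add: mult_ac)
qed

text \<open>The coefficients are rising factorials over factorials, increasing in
  \<open>\<alpha>\<close>; at \<open>\<alpha> = 2\<close> they equal \<open>n + 1\<close>.\<close>

lemma binom_fps_neg_nth_bound:
  assumes "0 \<le> \<alpha>" "\<alpha> \<le> 2"
  shows "\<bar>binom_fps (- \<alpha>) 1 $ n\<bar> \<le> real n + 1"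
proof -
  have "binom_fps (- \<alpha>) 1 $ n = pochhammer \<alpha> n / fact n"
    by (simp add: binom_fps_nth gbinomial_alternating)
  moreover have "0 \<le> pochhammer \<alpha> n" using assms by (auto simp: pochhammer_prod intro!: prod_nonneg)
  moreover have "pochhammer \<alpha> n \<le> pochhammer 2 n"
    using assms by (auto simp: pochhammer_prod intro!: prod_mono)
  moreover have "pochhammer (2::real) n = fact (Suc n)"
    using pochhammer_fact[of "Suc n", where ?'a = real] by (simp add: pochhammer_rec)
  ultimately show ?thesis by (simp add: divide_le_eq add.commute)
qed

section \<open>Choice of the exponents\<close>

text \<open>Over the integers, \<open>a = 2p + 1\<close>, \<open>b = -(p + 2)\<close> solves both
  \<open>a + 2b + 3 = 0\<close> and \<open>(p - 1)a + (p\<^sup>2 - 1)b + (p\<^sup>3 - 1) = 0\<close>;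
  reducing this solution modulo \<open>q\<close> makes both quantities multiples of \<open>q\<close>.\<close>

lemma exponents_exist:
  fixes p q :: nat
  assumes p: "prime p" "odd p" and q: "prime q" "odd q"
  obtains a b k N :: nat where "a < q" "b < q" "q * k = a + 2 * b + 3"
    "q * N = (p - 1) * a + (p\<^sup>2 - 1) * b + (p ^ 3 - 1)" "N > 0"
    "p \<noteq> q \<Longrightarrow> \<not> q dvd a + b + 1" "p = q \<Longrightarrow> a = 1 \<and> b = p - 2 \<and> p dvd N"
proof -
  have p3: "p \<ge> 3" using p prime_ge_2_nat[of p] by (cases "p = 2") auto
  have q3: "q \<ge> 3" using q prime_ge_2_nat[of q] by (cases "q = 2") auto
  define a where "a = nat ((2 * int p + 1) mod int q)"
  define b where "b = nat ((- (int p + 2)) mod int q)"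
  \<comment> \<open>The quotients of the two reductions modulo \<open>q\<close>, with the sign of
    \<open>b'\<close> chosen so that \<open>b = q * b' - (p + 2)\<close>.\<close>
  define a' where "a' = (2 * int p + 1) div int q"
  define b' where "b' = - ((- (int p + 2)) div int q)"
  have "int a = (2 * int p + 1) mod int q" using q3 by (simp add: a_def)
  then have a: "int a = 2 * int p + 1 - int q * a'"
    by (simp only: a'_def minus_mult_div_eq_mod)
  have "int b = (- (int p + 2)) mod int q" using q3 by (simp add: b_def)
  then have "int b = - (int p + 2) - int q * ((- (int p + 2)) div int q)"
    by (simp only: minus_mult_div_eq_mod)
  then have b: "int b = int q * b' - (int p + 2)" by (simp add: b'_def)
  have lt: "a < q" "b < q" using q3 by (simp_all add: a_def b_def nat_less_iff)
  have k: "int (a + 2 * b + 3) = int q * (2 * b' - a')"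
    by (simp add: a b algebra_simps)
  then have "2 * b' - a' \<ge> 0"
    using q3 by (metis of_nat_0_le_iff of_nat_0_less_iff not_le mult_pos_neg order.strict_trans2 gr0I not_numeral_le_zero)
  then have k': "q * nat (2 * b' - a') = a + 2 * b + 3"
    using k by (metis int_nat_eq of_nat_mult of_nat_eq_iff)
  define M where "M = (p - 1) * a + (p\<^sup>2 - 1) * b + (p ^ 3 - 1)"
  have M_eq: "int M = (int p - 1) * int a + (int p ^ 2 - 1) * int b + (int p ^ 3 - 1)"
    unfolding M_def of_nat_add of_nat_mult using p3 by (simp add: of_nat_diff)
  then have "int M = int q * ((int p ^ 2 - 1) * b' - (int p - 1) * a')"
    unfolding a b by algebra
  then have "q dvd M" by (metis dvd_triv_left int_dvd_int_iff)
  then obtain N where N: "M = q * N" by blast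
  have "p ^ 3 > 1" using p3 by (intro one_less_power) auto
  then have "M > 0" by (simp add: M_def)
  then have N0: "N > 0" using N by (cases N) auto
  \<comment> \<open>The integral solution gives \<open>(2 * p + 1) - (p + 2) + 1 = p\<close>, so
    \<open>a + b + 1\<close> is congruent to \<open>p\<close> modulo \<open>q\<close>.\<close>
  have not_dvd: "\<not> q dvd a + b + 1" if "p \<noteq> q"
  proof
    assume "q dvd a + b + 1"
    then have "int q dvd int (a + b + 1)" by (simp only: int_dvd_int_iff)
    moreover have "int (a + b + 1) = int p + int q * (b' - a')"
      by (simp add: a b algebra_simps)
    ultimately have "int q dvd int p" by (simp add: dvd_add_left_iff)
    then have "q dvd p" by (simp only: int_dvd_int_iff)
    then show False using that p(1) q(1) primes_dvd_imp_eq by blast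
  qed
  have diagonal: "a = 1 \<and> b = p - 2 \<and> p dvd N" if "p = q"
  proof -
    have "(1 + 2 * int p) mod int p = 1 mod int p"
      by (metis mod_mult_self2 mult.commute)
    then have a1: "a = 1" using that p3 by (simp add: a_def add.commute)
    have "(- (int p + 2)) mod int p = (int p - 2 + int p * (- 2)) mod int p" by simp
    also have "\<dots> = (int p - 2) mod int p" by (rule mod_mult_self2)
    also have "\<dots> = int p - 2" using p3 by (intro mod_pos_pos_trivial) auto
    finally have "nat ((- (int p + 2)) mod int p) = nat (int p - 2)" by (simp only:)
    then have b1: "b = p - 2" using that p3 by (simp add: b_def nat_diff_distrib)
    \<comment> \<open>With \<open>a = 1\<close> and \<open>b = p - 2\<close> the degree equation can
      be solved explicitly: \<open>N = 2 * p * (p - 1)\<close>.\<close>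
    have "int p * int N = int p * (int p * (2 * (int p - 1)))"
    proof -
      have "int p * int N = int M" using N that by simp
      also have "\<dots> = (int p - 1) + (int p ^ 2 - 1) * (int p - 2) + (int p ^ 3 - 1)"
        unfolding M_eq using a1 b1 p3 by (simp add: of_nat_diff)
      finally show ?thesis by (simp add: power2_eq_square power3_eq_cube algebra_simps)
    qed
    then have "int N = int p * (2 * (int p - 1))" using p3 by simp
    then have "p dvd N" by (metis dvd_triv_left int_dvd_int_iff)
    then show ?thesis using a1 b1 by simp
  qed
  show ?thesis
    by (rule that[OF lt k' N[symmetric, unfolded M_def] N0 not_dvd diagonal])
qed

section \<open>The integer \<open>W\<close> as a value of the product series\<close>

lemma powr_divide_power:
  fixes c :: real
  assumes "c > 0" "q > 0"
  shows "(c powr (real n / real q)) ^ q = c ^ n"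
proof -
  have "(c powr (real n / real q)) ^ q = (c powr (real n / real q)) powr real q"
    using assms by (simp add: powr_realpow)
  also have "\<dots> = c powr real n" using assms by (simp add: powr_powr)
  finally show ?thesis using assms by (simp add: powr_realpow)
qed

lemma geometric_quotient:
  fixes X :: real
  assumes "\<bar>X\<bar> > 1" "n > 0"
  shows "(X ^ n - 1) / (X - 1) = X ^ (n - 1) * ((1 - (1 / X) ^ n) / (1 - 1 / X))"
proof -
  have "X \<noteq> 0" "X \<noteq> 1" using assms by auto
  then have "X ^ n - 1 = X ^ n * (1 - (1 / X) ^ n)" "X - 1 = X * (1 - 1 / X)"
    by (simp_all add: right_diff_distrib power_one_over)
  moreover have "X ^ n = X * X ^ (n - 1)" using assms by (cases n) auto
  ultimately show ?thesis using \<open>X \<noteq> 0\<close> by simp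
qed

lemma unique_odd_root:
  fixes v w :: real
  assumes "odd q" "v ^ q = w ^ q"
  shows "v = w"
  using assms by (metis odd_real_root_power_cancel)

text \<open>Both sides have the same \<open>q\<close>-th power: the equation for \<open>k\<close>
  collects the powers of \<open>p\<close>, that for \<open>N\<close> the powers of \<open>X\<close>.
  Since \<open>q\<close> is odd, real \<open>q\<close>-th roots are unique, whatever the
  signs.\<close>

lemma product_root_eq:
  fixes X y z u :: real and p q a b k N :: nat
  assumes X: "\<bar>X\<bar> > 1" and q: "odd q" and p: "p > 0"
    and k: "q * k = a + 2 * b + 3"
    and N: "q * N = (p - 1) * a + (p\<^sup>2 - 1) * b + (p ^ 3 - 1)"
    and y: "real p * y ^ q = (X ^ p - 1) / (X - 1)"
    and z: "real p ^ 2 * z ^ q = (X ^ (p ^ 2) - 1) / (X - 1)"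
    and u: "real p ^ 3 * u ^ q = (X ^ (p ^ 3) - 1) / (X - 1)"
  defines "S \<equiv> binom_fps (- (real (a + b + 1) / real q)) 1 * binom_fps (real a / real q) p
    * binom_fps (real b / real q) (p ^ 2) * binom_fps (1 / real q) (p ^ 3)"
  shows "fps_conv_radius S \<ge> 1"
    and "real p ^ k * y ^ a * z ^ b * u = X ^ N * eval_fps S (1 / X)"
proof -
  have q0: "q > 0" using q by (auto intro: odd_pos)
  define t where "t = 1 / X"
  have t: "\<bar>t\<bar> < 1" using X by (simp add: t_def)
  have radius1: "fps_conv_radius (binom_fps \<alpha> e) \<ge> 1" if "e > 0" for \<alpha> e
    using that by (rule fps_conv_radius_binom_fps)
  note radii = radius1 fps_conv_radius_mult_ge
  show "fps_conv_radius S \<ge> 1" unfolding S_def using p by (intro radii) auto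
  have inside: "ereal \<bar>t\<bar> < fps_conv_radius F" if "fps_conv_radius F \<ge> 1" for F :: "real fps"
    using that t by (intro less_le_trans[OF _ that]) (simp add: one_ereal_def)
  define c where "c e = 1 - t ^ e" for e
  \<comment> \<open>Positive bases are needed to handle the real powers, also when \<open>X\<close>
    is negative.\<close>
  have c: "c e > 0" if "e > 0" for e
  proof -
    have "\<bar>t ^ e\<bar> < 1" using that t by (simp add: power_abs power_less_one_iff)
    then show ?thesis by (simp add: c_def)
  qed
  have eval_S: "eval_fps S t = c 1 powr (- (real (a + b + 1) / real q)) * c p powr (real a / real q)
      * c (p ^ 2) powr (real b / real q) * c (p ^ 3) powr (1 / real q)"
    unfolding S_def using p t
    by (simp add: eval_fps_mult inside radii eval_binom_fps c_def)
  have "eval_fps S t ^ q = c p ^ a * c (p ^ 2) ^ b * c (p ^ 3) / c 1 ^ (a + b + 1)"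
  proof -
    have "c 1 powr (- (real (a + b + 1) / real q)) = 1 / (c 1 powr (real (a + b + 1) / real q))"
      by (simp only: powr_minus_divide)
    then show ?thesis
      using powr_divide_power[OF c q0, of 1 "a + b + 1"] powr_divide_power[OF c q0, of p a]
        powr_divide_power[OF c q0, of "p ^ 2" b] powr_divide_power[OF c q0, of "p ^ 3" 1] p
      unfolding eval_S by (simp add: power_mult_distrib power_divide)
  qed
  then have "(X ^ N * eval_fps S t) ^ q = X ^ (q * N) * (c p ^ a * c (p ^ 2) ^ b * c (p ^ 3) / c 1 ^ (a + b + 1))"
    by (simp add: power_mult_distrib mult.commute flip: power_mult)
  also have "\<dots> = (X ^ (p - 1) * (c p / c 1)) ^ a * (X ^ (p\<^sup>2 - 1) * (c (p ^ 2) / c 1)) ^ b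
      * (X ^ (p ^ 3 - 1) * (c (p ^ 3) / c 1))"
  proof -
    have "X ^ (q * N) = (X ^ (p - 1)) ^ a * (X ^ (p\<^sup>2 - 1)) ^ b * X ^ (p ^ 3 - 1)"
      unfolding N by (simp only: power_add power_mult)
    then show ?thesis by (simp only: power_add power_mult_distrib power_divide power_one_right) simp
  qed
  also have "X ^ (p - 1) * (c p / c 1) = real p * y ^ q"
    using geometric_quotient[OF X, of p] p y by (simp add: c_def t_def)
  also have "X ^ (p\<^sup>2 - 1) * (c (p ^ 2) / c 1) = real p ^ 2 * z ^ q"
    using geometric_quotient[OF X, of "p ^ 2"] p z by (simp add: c_def t_def)
  also have "X ^ (p ^ 3 - 1) * (c (p ^ 3) / c 1) = real p ^ 3 * u ^ q"
    using geometric_quotient[OF X, of "p ^ 3"] p u by (simp add: c_def t_def)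
  also have "(real p * y ^ q) ^ a * (real p ^ 2 * z ^ q) ^ b * (real p ^ 3 * u ^ q)
      = real p ^ (a + 2 * b + 3) * (y ^ q) ^ a * (z ^ q) ^ b * u ^ q"
    by (simp add: power_add power_mult power_mult_distrib)
  also have "\<dots> = (real p ^ k * y ^ a * z ^ b * u) ^ q"
    unfolding k[symmetric] by (simp add: power_mult_distrib mult.commute flip: power_mult)
  finally show "real p ^ k * y ^ a * z ^ b * u = X ^ N * eval_fps S (1 / X)"
    unfolding t_def[symmetric] by (rule unique_odd_root[OF q sym])
qed

text \<open>The first factor grows linearly because \<open>(a + b + 1) / q\<close> is at most 2.
  Each of the other three has its exponent in the unit interval and costs a factor 2.\<close>

lemma product_series_nth_bound:
  assumes "a < q" "b < q" "p > 0"
  shows "\<bar>(binom_fps (- (real (a + b + 1) / real q)) 1 * binom_fps (real a / real q) p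
    * binom_fps (real b / real q) (p ^ 2) * binom_fps (1 / real q) (p ^ 3)) $ n\<bar> \<le> 8 * (real n + 1)"
proof -
  have "\<bar>binom_fps (- (real (a + b + 1) / real q)) 1 $ n\<bar> \<le> 1 * (real n + 1)" for n
    unfolding mult_1_left using assms by (intro binom_fps_neg_nth_bound) (auto simp: divide_le_eq)
  moreover have "(\<Sum>i\<le>n. \<bar>binom_fps (real a / real q) p $ i\<bar>) \<le> 2"
    "(\<Sum>i\<le>n. \<bar>binom_fps (real b / real q) (p ^ 2) $ i\<bar>) \<le> 2"
    "(\<Sum>i\<le>n. \<bar>binom_fps (1 / real q) (p ^ 3) $ i\<bar>) \<le> 2" for n
    using assms by (intro binom_fps_abs_sum_le; simp add: divide_le_eq)+
  ultimately have "\<bar>(binom_fps (- (real (a + b + 1) / real q)) 1 * binom_fps (real a / real q) p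
    * binom_fps (real b / real q) (p ^ 2) * binom_fps (1 / real q) (p ^ 3)) $ n\<bar> \<le> (1 * 2 * 2 * 2) * (real n + 1)"
    by (intro fps_mult_nth_bound)
  then show ?thesis by simp
qed

section \<open>Assembling the bound\<close>

text \<open>For \<open>p \<noteq> q\<close> the factor \<open>(1 - t)\<^sup>-\<^sup>(\<^sup>a\<^sup>+\<^sup>b\<^sup>+\<^sup>1\<^sup>)\<^sup>/\<^sup>q\<close> carries the denominators.
  For \<open>p = q\<close> it degenerates to \<open>1 / (1 - t)\<close>, and \<open>(1 - t\<^sup>p)\<^sup>1\<^sup>/\<^sup>p\<close> takes over.\<close>

lemma simultaneous_power_bound:
  fixes x y z u :: int and p q a b k N :: nat
  assumes p: "prime p" and q: "prime q" "odd q" and x: "\<bar>x\<bar> > 2"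
    and ab: "a < q" "b < q" and k: "q * k = a + 2 * b + 3"
    and N: "q * N = (p - 1) * a + (p\<^sup>2 - 1) * b + (p ^ 3 - 1)" "N > 0"
    and neq: "p \<noteq> q \<Longrightarrow> \<not> q dvd a + b + 1" and eq: "p = q \<Longrightarrow> a = 1 \<and> b = p - 2 \<and> p dvd N"
    and y: "real p * real_of_int y ^ q = (real_of_int x ^ p - 1) / (real_of_int x - 1)"
    and z: "real p ^ 2 * real_of_int z ^ q = (real_of_int x ^ (p ^ 2) - 1) / (real_of_int x - 1)"
    and u: "real p ^ 3 * real_of_int u ^ q = (real_of_int x ^ (p ^ 3) - 1) / (real_of_int x - 1)"
  shows "real_of_int \<bar>x\<bar> - 2 \<le> 8 * (real N + 2) * real q ^ den_exp q N"
proof -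
  have p2: "p \<ge> 2" and q2: "q \<ge> 2" using p q prime_ge_2_nat by auto
  define F0 where "F0 = binom_fps (- (real (a + b + 1) / real q)) 1"
  define F1 where "F1 = binom_fps (real a / real q) p"
  define F2 where "F2 = binom_fps (real b / real q) (p ^ 2)"
  define F3 where "F3 = binom_fps (1 / real q) (p ^ 3)"
  define S where "S = F0 * F1 * F2 * F3"
  define W where "W = int p ^ k * y ^ a * z ^ b * u"
  have X: "\<bar>real_of_int x\<bar> > 1" using x by linarith
  note S_defs = S_def F0_def F1_def F2_def F3_def
  have radius: "fps_conv_radius S \<ge> 1"
    and W: "real_of_int W = real_of_int x ^ N * eval_fps S (1 / real_of_int x)"
    using product_root_eq[OF X q(2) _ k N(1) y z u] p2 by (simp_all add: S_defs W_def)
  have bound: "\<bar>S $ n\<bar> \<le> 8 * (real n + 1)" for n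
    unfolding S_defs using product_series_nth_bound[OF ab] p2 by simp
  have neg: "real_of_int (- int (a + b + 1)) / real q = - (real (a + b + 1) / real q)"
    by (simp only: of_int_minus of_int_of_nat_eq minus_divide_left)
  have den0: "den_le q (\<lambda>n. den_exp q (n div 1)) F0"
    using den_le_binom_fps[OF q(1), of 1 "- int (a + b + 1)"] unfolding F0_def neg .
  have den1: "den_le q (\<lambda>n. den_exp q (n div p)) F1"
    using den_le_binom_fps[OF q(1), of p "int a"] by (simp add: F1_def)
  have den2: "den_le q (\<lambda>n. den_exp q (n div p ^ 2)) F2"
    using den_le_binom_fps[OF q(1), of "p ^ 2" "int b"] by (simp add: F2_def)
  have den3: "den_le q (\<lambda>n. den_exp q (n div p ^ 3)) F3"
    using den_le_binom_fps[OF q(1), of "p ^ 3" 1] by (simp add: F3_def)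
  have coarser: "den_le q (\<lambda>n. den_exp q (n div d)) F"
    if "den_le q (\<lambda>n. den_exp q (n div e)) F" "0 < d" "d \<le> e" for d e F
    using that by (intro den_le_mono[OF that(1)] den_exp_mono div_le_mono2) auto
  have pow: "p \<le> p ^ 2" "p ^ 2 \<le> p ^ 3" "p \<le> p ^ 3"
    using p2 by (auto intro: self_le_power power_increasing)
  show ?thesis
  proof (cases "p = q")
    case False
    \<comment> \<open>The series in powers of \<open>p ^ 2\<close> and \<open>p ^ 3\<close> also
      satisfy the weaker bound for \<open>p\<close>, which gives the cofactor of \<open>F0\<close> a
      common bound.\<close>
    have den: "den_le q (\<lambda>n. den_exp q (n div (1 * p))) (F1 * (F2 * F3))"
      unfolding mult_1_left using p2 pow
      by (intro den_le_mult den_exp_div_superadd q den1 coarser[OF den2] coarser[OF den3]) auto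
    have "\<not> int q dvd - int (a + b + 1)"
      using neq[OF False] unfolding dvd_minus_iff int_dvd_int_iff .
    from binom_fps_exact_denominator[OF q(1) this, of 1 N]
    obtain r where r: "real q ^ den_exp q (N div 1) * F0 $ N = real_of_int r" "\<not> int q dvd r"
      unfolding F0_def neg by auto
    have S: "S = F0 * (F1 * (F2 * F3))" by (simp add: S_def mult.assoc)
    have "(F1 * (F2 * F3)) $ 0 = 1" by (simp add: F1_def F2_def F3_def)
    from runge_bound[OF q(1) p2 _ _ N(2) den0 den this r _ x, folded S, OF _ _ bound radius W]
    show ?thesis by simp
  next
    case True
    have ab1: "a = 1" "b = p - 2" "p dvd N" using eq[OF True] by auto
    then have "real (a + b + 1) / real q = 1" using True p2 by simp
    then have F0: "F0 $ n = 1" for n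
      by (simp add: F0_def binom_fps_nth gbinomial_alternating pochhammer_fact[symmetric])
    \<comment> \<open>Here \<open>F1\<close> leads with \<open>e = p\<close>, so its cofactor must
      satisfy the bound for \<open>p * p\<close>; \<open>F0\<close> has integer
      coefficients.\<close>
    have den: "den_le q (\<lambda>n. den_exp q (n div (p * p))) (F0 * (F2 * F3))"
      unfolding power2_eq_square[symmetric] using p2 pow
      by (intro den_le_mult den_exp_div_superadd q den2 coarser[OF den3]) (auto simp: den_le_def F0)
    have "\<not> int q dvd int a" using ab1 q2 by simp
    from binom_fps_exact_denominator[OF q(1) this ab1(3)]
    obtain r where r: "real q ^ den_exp q (N div p) * F1 $ N = real_of_int r" "\<not> int q dvd r"
      by (auto simp: F1_def)
    have S: "S = F1 * (F0 * (F2 * F3))" by (simp add: S_def mult_ac)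
    have "(F0 * (F2 * F3)) $ 0 = 1" by (simp add: F0 F2_def F3_def)
    from runge_bound[OF q(1) p2 _ ab1(3) N(2) den1 den this r _ x, folded S, OF _ bound radius W]
    have "real_of_int \<bar>x\<bar> - 2 \<le> 8 * (real N + 2) * real q ^ den_exp q (N div p)"
      using p2 by simp
    also have "\<dots> \<le> 8 * (real N + 2) * real q ^ den_exp q N"
      using q2 by (intro mult_left_mono power_increasing den_exp_mono) auto
    finally show ?thesis .
  qed
qed

theorem theorem3:
  fixes x y z u :: int and p q :: nat
  assumes "x \<noteq> 1"
    and "prime p" "odd p" "prime q" "odd q"
    and "real p * real_of_int y ^ q = (real_of_int x ^ p - 1) / (real_of_int x - 1)"
    and "real p ^ 2 * real_of_int z ^ q = (real_of_int x ^ (p ^ 2) - 1) / (real_of_int x - 1)"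
    and "real p ^ 3 * real_of_int u ^ q = (real_of_int x ^ (p ^ 3) - 1) / (real_of_int x - 1)"
  shows "real_of_int \<bar>x\<bar> <
    17 * real p ^ 3 * (max 1 (real p / real q)) ^ 3
      * real q powr (real p ^ 2 + real p - 2 + (real p ^ 3 - 1) / (real q - 1))"
proof -
  have p3: "real p \<ge> 3" using assms prime_ge_2_nat[of p] by (cases "p = 2") auto
  have q3: "real q \<ge> 3" using assms prime_ge_2_nat[of q] by (cases "q = 2") auto
  define E where "E = real p ^ 2 + real p - 2 + (real p ^ 3 - 1) / (real q - 1)"
  define Q where "Q = real q powr E"
  have p_ge: "real p ^ 2 \<ge> 3 * real p" "real p ^ 3 \<ge> 3 * real p ^ 2"
    using p3 by (simp_all add: power2_eq_square power3_eq_cube mult_mono)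
  have "(real p ^ 3 - 1) / (real q - 1) \<ge> 0" using q3 p3 p_ge by (intro divide_nonneg_nonneg) linarith+
  then have "E \<ge> 0" unfolding E_def using p3 p_ge by linarith
  then have Q: "Q \<ge> 1" unfolding Q_def using q3 by (intro ge_one_powr_ge_zero) auto
  \<comment> \<open>The factor with the maximum is at least 1, so a bound by
    \<open>17 * real p ^ 3 * Q\<close> suffices.\<close>
  have "max 1 (real p / real q) ^ 3 \<ge> 1" by (intro one_le_power) simp
  then have "17 * real p ^ 3 * Q * 1 \<le> 17 * real p ^ 3 * Q * max 1 (real p / real q) ^ 3"
    using Q by (intro mult_left_mono) auto
  then have weaken: "17 * real p ^ 3 * Q \<le> 17 * real p ^ 3 * max 1 (real p / real q) ^ 3 * Q"
    by (simp add: mult_ac)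
  \<comment> \<open>This settles \<open>\<bar>x\<bar> \<le> 2\<close> and later absorbs the 2 in
    \<open>\<bar>x\<bar> - 2\<close>.\<close>
  have pQ: "27 \<le> real p ^ 3 * Q"
  proof -
    have "27 \<le> real p ^ 3" using p3 p_ge by linarith
    then show ?thesis using Q mult_mono[of 27 "real p ^ 3" 1 Q] by simp
  qed
  have "real_of_int \<bar>x\<bar> < 17 * real p ^ 3 * Q"
  proof (cases "\<bar>x\<bar> > 2")
    case True
    obtain a b k N :: nat where ab: "a < q" "b < q" and k: "q * k = a + 2 * b + 3"
      and N: "q * N = (p - 1) * a + (p\<^sup>2 - 1) * b + (p ^ 3 - 1)" "N > 0"
      and pq: "p \<noteq> q \<Longrightarrow> \<not> q dvd a + b + 1" "p = q \<Longrightarrow> a = 1 \<and> b = p - 2 \<and> p dvd N"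
      using exponents_exist[OF assms(2-5)] by metis
    have "real (q * N) = (real p - 1) * real a + (real p ^ 2 - 1) * real b + (real p ^ 3 - 1)"
      unfolding N(1) of_nat_add of_nat_mult using p3 by (simp add: of_nat_diff)
    \<comment> \<open>The largest admissible residues \<open>a = b = q - 1\<close> give the worst
      degree.\<close>
    also have "\<dots> \<le> (real p - 1) * (real q - 1) + (real p ^ 2 - 1) * (real q - 1) + (real p ^ 3 - 1)"
    proof -
      have "real a \<le> real q - 1" "real b \<le> real q - 1" using ab by linarith+
      then show ?thesis using p3 p_ge by (intro add_mono mult_left_mono) auto
    qed
    finally have qN: "real q * real N \<le> (real q - 1) * (real p ^ 2 + real p - 2) + (real p ^ 3 - 1)"
      by (simp add: algebra_simps)
    have "real (den_exp q N) \<le> real q * real N / (real q - 1)"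
      using assms(4) by (rule den_exp_le)
    also have "\<dots> \<le> ((real q - 1) * (real p ^ 2 + real p - 2) + (real p ^ 3 - 1)) / (real q - 1)"
      using qN q3 by (intro divide_right_mono) auto
    also have "\<dots> = E" using q3 by (simp add: E_def add_divide_distrib)
    finally have "real q powr real (den_exp q N) \<le> Q"
      unfolding Q_def using q3 by (intro powr_mono) auto
    then have den: "real q ^ den_exp q N \<le> Q" using q3 by (simp add: powr_realpow)
    \<comment> \<open>From \<open>p \<ge> 3\<close>, \<open>p ^ 2 + p\<close> is at most two thirds
      of \<open>p ^ 3\<close>; from \<open>q \<ge> 3\<close>, the remaining \<open>p ^ 3\<close> is
      at most one third of \<open>q * p ^ 3\<close>.\<close>
    have "real N + 2 \<le> real p ^ 3"
    proof -
      have "3 * real p \<le> 3 * real p ^ 2" "0 \<le> real p ^ 3" using p3 p_ge by linarith+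
      then have "3 * (real p ^ 2 + real p) \<le> 2 * real p ^ 3"
        using p_ge(2) unfolding distrib_left by linarith
      then have "real q * (3 * (real p ^ 2 + real p)) \<le> real q * (2 * real p ^ 3)"
        by (intro mult_left_mono) auto
      moreover have "3 * real p ^ 3 \<le> real q * real p ^ 3"
        using q3 by (intro mult_right_mono) auto
      moreover have "real q * (real N + 2) \<le> real q * (real p ^ 2 + real p) + real p ^ 3"
      proof -
        have "(real q - 1) * (real p ^ 2 + real p - 2)
            = real q * (real p ^ 2 + real p) - 2 * real q - real p ^ 2 - real p + 2"
          by (simp add: algebra_simps)
        moreover have "real p ^ 2 \<ge> 0" by simp
        ultimately show ?thesis using qN p3 unfolding distrib_left[of "real q" "real N"] by linarith
      qed
      ultimately have "real q * (real N + 2) \<le> real q * real p ^ 3"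
        by linarith
      then show ?thesis using q3 by simp
    qed
    then have "8 * (real N + 2) * real q ^ den_exp q N \<le> 8 * real p ^ 3 * Q"
      using den by (intro mult_mono) auto
    then have "real_of_int \<bar>x\<bar> - 2 \<le> 8 * real p ^ 3 * Q"
      using simultaneous_power_bound[OF assms(2,4,5) True ab k N pq assms(6-8)] by linarith
    then show ?thesis using pQ by linarith
  qed (use pQ in linarith)
  with weaken show ?thesis unfolding Q_def E_def by linarith
qed

end
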